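(* Let $\mu\in\mathbb{R}$, $\sigma>0$, and let $X_{1,1},X_{1,2},X_{2,1},X_{2,2}$ be independent random variables, each normally distributed with mean $\mu$ and variance $\sigma^2$. Let $\tilde X$ be the first addend of the larger of the two sums $X_{1,1}+X_{1,2}$ and $X_{2,1}+X_{2,2}$. Then $\tilde X$ has density $$f_{\tilde X}(x)=(2\pi\sigma^2)^{-\frac12}\exp\left(-\frac{(\mu-x)^2}{2\sigma^2}\right)\operatorname{erfc}\left(\frac{\mu-x}{\sqrt{6\sigma^2}}\right),\qquad x\in\mathbb{R}.$$
   Context: The first addend of the larger sum is $\tilde X:=X_{J,1}$, where $J\in\{1,2\}$ is the almost surely unique index maximizing $X_{j,1}+X_{j,2}$. Here $\operatorname{erfc}(x)=1-\operatorname{erf}(x)$ with $\operatorname{erf}(x)=\frac{2}{\sqrt\pi}\int_0^x\exp(-t^2)\,dt$. *)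

theory Defs
  imports "HOL-Probability.Probability"
begin

text \<open>
  The interval integral is oriented, so the formula for \<open>erf\<close> is also the intended one for
  negative arguments.
\<close>

definition erf :: "real \<Rightarrow> real" where
  "erf x = 2 / sqrt pi * (LBINT t=0..x. exp (- t\<^sup>2))"

definition erfc :: "real \<Rightarrow> real" where
  "erfc x = 1 - erf x"

end

theory Submission
  imports Defs
begin

text \<open>
  Put \<open>W = X 2 1 + X 2 2 - X 1 2\<close>, which is normal with mean \<open>\<mu>\<close> and variance \<open>3 \<sigma>\<^sup>2\<close> and
  independent of \<open>X 1 1\<close>. The first sum wins iff \<open>W \<le> X 1 1\<close>, so on that event \<open>X 1 1\<close> has the
  subdensity given by its own density times the distribution function of \<open>W\<close>, which is
  \<open>erfc ((\<mu> - x) / sqrt (6 \<sigma>\<^sup>2)) / 2\<close>. By symmetry the event that the second sum wins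
  contributes the same amount, and ties have probability zero.
\<close>

section \<open>The complementary error function\<close>

text \<open>The fundamental theorem of calculus, applied to the oriented integral so that negative
  arguments need no separate case.\<close>

lemma DERIV_erf: "DERIV erf x :> 2 / sqrt pi * exp (- x\<^sup>2)"
proof -
  let ?b = "\<bar>x\<bar> + 1"
  have "((\<lambda>u. LBINT y=(0::real)..u. exp (- y\<^sup>2)) has_vector_derivative exp (- x\<^sup>2))
      (at x within {- ?b..?b})"
    by (rule interval_integral_FTC2) (auto intro!: continuous_intros)
  moreover have "at x within {- ?b..?b} = at x"
    by (rule at_within_interior) (auto simp: interior_atLeastAtMost_real)
  ultimately have "((\<lambda>u. LBINT y=0..u. exp (- y\<^sup>2)) has_real_derivative exp (- x\<^sup>2)) (at x)"
    by (simp add: has_real_derivative_iff_has_vector_derivative zero_ereal_def)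
  from DERIV_cmult[OF this, of "2 / sqrt pi"] show ?thesis
    by (simp add: erf_def[abs_def])
qed

text \<open>The Gaussian integral over the half-line is \<open>sqrt pi / 2\<close>, which the factor
  \<open>2 / sqrt pi\<close> normalises to 1.\<close>

lemma erf_at_top: "(erf \<longlongrightarrow> 1) at_top"
proof -
  let ?f = "\<lambda>x::real. indicator {0..} x *\<^sub>R exp (- x\<^sup>2)"
  have "((\<lambda>y. \<integral>x. indicator {..y} x *\<^sub>R ?f x \<partial>lborel) \<longlongrightarrow> (\<integral>x. ?f x \<partial>lborel)) at_top"
    using gaussian_moment_0 by (intro tendsto_integral_at_top) (auto simp: has_bochner_integral_iff)
  moreover have "(\<integral>x. ?f x \<partial>lborel) = sqrt pi / 2"
    using gaussian_moment_0 by (rule has_bochner_integral_integral_eq)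
  ultimately have "((\<lambda>y. 2 / sqrt pi * (\<integral>x. indicator {..y} x *\<^sub>R ?f x \<partial>lborel)) \<longlongrightarrow>
      2 / sqrt pi * (sqrt pi / 2)) at_top"
    by (intro tendsto_mult tendsto_const) (simp only:)
  \<comment> \<open>For nonnegative \<open>y\<close> the oriented integral is an ordinary integral
    truncated at \<open>y\<close>; the limit at infinity needs no more.\<close>
  moreover have "eventually (\<lambda>y. 2 / sqrt pi * (\<integral>x. indicator {..y} x *\<^sub>R ?f x \<partial>lborel) = erf y) at_top"
    using eventually_ge_at_top[of 0]
  proof eventually_elim
    case (elim y)
    then have "(LBINT t=ereal 0..ereal y. exp (- t\<^sup>2)) = (LBINT t:{0..y}. exp (- t\<^sup>2))"
      by (rule interval_integral_Icc)
    also have "\<dots> = (\<integral>x. indicator {..y} x *\<^sub>R ?f x \<partial>lborel)"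
      unfolding set_lebesgue_integral_def
      by (intro Bochner_Integration.integral_cong) (auto split: split_indicator)
    finally show ?case by (simp add: erf_def zero_ereal_def)
  qed
  ultimately show ?thesis
    using tendsto_cong by (fastforce simp: field_simps)
qed

lemma borel_measurable_erfc [measurable]: "erfc \<in> borel_measurable borel"
proof -
  have "continuous_on UNIV erf"
    by (rule DERIV_continuous_on) (rule DERIV_subset[OF DERIV_erf], simp)
  then show ?thesis
    unfolding erfc_def[abs_def]
    by (intro borel_measurable_continuous_onI continuous_intros)
qed

text \<open>\<open>erf\<close> is an antiderivative of the integrand with limit 1 at infinity, so
  the tail is 1 minus its value at \<open>z\<close>.\<close>

lemma nn_integral_gaussian_tail:
  "(\<integral>\<^sup>+t. ennreal (2 / sqrt pi * exp (- t\<^sup>2)) * indicator {z..} t \<partial>lborel) = ennreal (erfc z)"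
  unfolding erfc_def by (rule nn_integral_FTC_atLeast[OF _ DERIV_erf _ erf_at_top]) auto

text \<open>\<open>erf\<close> is nondecreasing and hence stays below its limit 1.\<close>

lemma erfc_nonneg: "0 \<le> erfc z"
proof -
  have "erf z \<le> 1"
  proof (rule tendsto_lowerbound[OF erf_at_top])
    have "erf z \<le> erf y" if "z \<le> y" for y
      using that by (rule DERIV_nonneg_imp_nondecreasing) (use DERIV_erf in force)
    then show "eventually (\<lambda>y. erf z \<le> erf y) at_top"
      by (rule eventually_mono[OF eventually_ge_at_top])
  qed simp
  then show ?thesis by (simp add: erfc_def)
qed

text \<open>The normal distribution function in terms of \<open>erfc\<close>. The substitution
  \<open>w = \<mu> - sqrt 2 * \<sigma> * t\<close> standardises the density; its negative slope
  turns the lower tail into the upper tail that \<open>erfc\<close> measures.\<close>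

lemma emeasure_normal_atMost:
  assumes "0 < \<sigma>"
  shows "emeasure (density lborel (\<lambda>x. ennreal (normal_density \<mu> \<sigma> x))) {..x} =
    ennreal (erfc ((\<mu> - x) / (sqrt 2 * \<sigma>)) / 2)"
proof -
  let ?c = "sqrt 2 * \<sigma>" and ?z = "(\<mu> - x) / (sqrt 2 * \<sigma>)"
  have c: "0 < ?c" using assms by simp
  have "emeasure (density lborel (\<lambda>x. ennreal (normal_density \<mu> \<sigma> x))) {..x} =
      (\<integral>\<^sup>+w. ennreal (normal_density \<mu> \<sigma> w) * indicator {..x} w \<partial>lborel)"
    by (intro emeasure_density) auto
  also have "\<dots> = ennreal \<bar>- ?c\<bar> * (\<integral>\<^sup>+t. ennreal (normal_density \<mu> \<sigma> (\<mu> + - ?c * t)) *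
      indicator {..x} (\<mu> + - ?c * t) \<partial>lborel)"
    using c by (intro nn_integral_real_affine) auto
  also have "\<dots> = (\<integral>\<^sup>+t. ennreal ?c * (ennreal (normal_density \<mu> \<sigma> (\<mu> + - ?c * t)) *
      indicator {..x} (\<mu> + - ?c * t)) \<partial>lborel)"
    using c by (subst nn_integral_cmult) auto
  also have "\<dots> = (\<integral>\<^sup>+t. ennreal (1 / 2) *
      (ennreal (2 / sqrt pi * exp (- t\<^sup>2)) * indicator {?z..} t) \<partial>lborel)"
  proof (rule nn_integral_cong)
    fix t :: real
    \<comment> \<open>The Jacobian cancels \<open>sqrt 2 * \<sigma>\<close> in the normalising
      constant. What remains is \<open>1 / sqrt pi\<close>, half the constant of
      \<open>erf\<close>.\<close>
    have dens: "?c * normal_density \<mu> \<sigma> (\<mu> + - ?c * t) = 1 / 2 * (2 / sqrt pi * exp (- t\<^sup>2))"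
      using assms by (simp add: normal_density_def real_sqrt_mult power_mult_distrib)
    have "\<mu> + - ?c * t \<le> x \<longleftrightarrow> ?z \<le> t"
      using c by (simp add: pos_divide_le_eq algebra_simps)
    then have ind: "indicator {..x} (\<mu> + - ?c * t) = (indicator {?z..} t :: ennreal)"
      by (simp add: indicator_def)
    have "ennreal ?c * ennreal (normal_density \<mu> \<sigma> (\<mu> + - ?c * t)) =
        ennreal (1 / 2) * ennreal (2 / sqrt pi * exp (- t\<^sup>2))"
      unfolding ennreal_mult'[OF less_imp_le[OF c], symmetric] dens by (rule ennreal_mult') simp
    then show "ennreal ?c * (ennreal (normal_density \<mu> \<sigma> (\<mu> + - ?c * t)) *
        indicator {..x} (\<mu> + - ?c * t)) =
        ennreal (1 / 2) * (ennreal (2 / sqrt pi * exp (- t\<^sup>2)) * indicator {?z..} t)"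
      unfolding ind by (metis mult.assoc)
  qed
  also have "\<dots> = ennreal (1 / 2) * ennreal (erfc ?z)"
    unfolding nn_integral_gaussian_tail[of ?z, symmetric] by (intro nn_integral_cmult) auto
  also have "\<dots> = ennreal (erfc ?z / 2)"
    by (subst ennreal_mult'[symmetric]) auto
  finally show ?thesis .
qed

section \<open>Comparing independent random variables\<close>

text \<open>By independence the joint law is the product of the two marginal laws, and Tonelli's
  theorem integrates the measures of the slices of \<open>B\<close>.\<close>

lemma (in prob_space) emeasure_indep_var_pair:
  assumes indep: "indep_var borel X borel Y"
    and X: "distributed M lborel X f" and Y: "distributed M lborel Y g"
    and B [measurable]: "B \<in> sets (borel \<Otimes>\<^sub>M borel)"
  shows "emeasure M {\<omega> \<in> space M. (X \<omega>, Y \<omega>) \<in> B} =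
    (\<integral>\<^sup>+x. f x * emeasure (density lborel g) (Pair x -` B) \<partial>lborel)"
proof -
  have [measurable]: "X \<in> borel_measurable M" "Y \<in> borel_measurable M"
    using X Y by (auto simp: distributed_def)
  have f [measurable]: "f \<in> borel_measurable borel"
    using X by (simp add: distributed_def)
  have dX: "distr M borel X = density lborel f"
    using distributed_distr_eq_density[OF X] by (simp cong: distr_cong)
  have dY: "distr M borel Y = density lborel g"
    using distributed_distr_eq_density[OF Y] by (simp cong: distr_cong)
  interpret Y: prob_space "density lborel g"
    unfolding dY[symmetric] by (rule prob_space_distr) simp
  have B': "B \<in> sets (density lborel f \<Otimes>\<^sub>M density lborel g)"
    using B by (simp cong: sets_pair_measure_cong)
  have "emeasure M {\<omega> \<in> space M. (X \<omega>, Y \<omega>) \<in> B} =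
      emeasure (distr M (borel \<Otimes>\<^sub>M borel) (\<lambda>\<omega>. (X \<omega>, Y \<omega>))) B"
    by (subst emeasure_distr) (auto intro!: arg_cong[where f="emeasure M"])
  also have "\<dots> = emeasure (density lborel f \<Otimes>\<^sub>M density lborel g) B"
    using indep unfolding indep_var_distribution_eq dX dY by simp
  also have "\<dots> = (\<integral>\<^sup>+x. emeasure (density lborel g) (Pair x -` B) \<partial>density lborel f)"
    using B' by (rule Y.emeasure_pair_measure_alt)
  also have "\<dots> = (\<integral>\<^sup>+x. f x * emeasure (density lborel g) (Pair x -` B) \<partial>lborel)"
    using Y.measurable_emeasure_Pair[OF B'] by (intro nn_integral_density) auto
  finally show ?thesis .
qed

text \<open>Moving \<open>X b\<close> to the other side leaves a comparison of two independent
  variables. The pair formula then gives both claims: its nonempty slices are half-lines for the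
  inequality and single points for a tie. The indices are generic so that either sum can take the
  role of the winner.\<close>

lemma (in prob_space)
  fixes X :: "'i \<Rightarrow> 'a \<Rightarrow> real"
  assumes \<sigma>: "0 < \<sigma>"
    and indep: "indep_vars (\<lambda>_. borel) X {a, b, c, d}"
    and distinct: "distinct [a, b, c, d]"
    and normal: "\<And>i. i \<in> {a, b, c, d} \<Longrightarrow> distributed M lborel (X i) (normal_density \<mu> \<sigma>)"
  shows emeasure_normal_sums_le: "S \<in> sets borel \<Longrightarrow>
      emeasure M {\<omega> \<in> space M. X a \<omega> \<in> S \<and> X c \<omega> + X d \<omega> \<le> X a \<omega> + X b \<omega>} =
      (\<integral>\<^sup>+x. ennreal (normal_density \<mu> \<sigma> x * erfc ((\<mu> - x) / sqrt (6 * \<sigma>\<^sup>2)) / 2) * indicator S x \<partial>lborel)"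
    and AE_normal_sums_neq: "AE \<omega> in M. X c \<omega> + X d \<omega> \<noteq> X a \<omega> + X b \<omega>"
proof -
  let ?s = "sqrt (3 * \<sigma>\<^sup>2)"
  let ?g = "\<lambda>x. ennreal (normal_density \<mu> ?s x)"
  \<comment> \<open>The minus sign of \<open>X b\<close> becomes a scaling, which makes
    \<open>W\<close> a plain sum over part of one independent family, as
    \<open>indep_vars_sum\<close> and \<open>sum_indep_normal\<close> expect.\<close>
  define s where "s i = (if i = b then - 1 else 1 :: real)" for i
  define Y where "Y i \<omega> = s i * X i \<omega>" for i \<omega>
  define W where "W \<omega> = (\<Sum>i\<in>{b, c, d}. Y i \<omega>)" for \<omega>
  have W: "W \<omega> = X c \<omega> + X d \<omega> - X b \<omega>" for \<omega>
    using distinct by (auto simp: W_def Y_def s_def)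
  have indepY: "indep_vars (\<lambda>_. borel) Y {a, b, c, d}"
    unfolding Y_def[abs_def] by (rule indep_vars_compose2[OF indep]) simp
  have "indep_var borel (Y a) borel W"
    unfolding W_def[abs_def] using indepY distinct by (intro indep_vars_sum) auto
  moreover have "Y a = X a"
    using distinct by (simp add: Y_def s_def fun_eq_iff)
  ultimately have indepW: "indep_var borel (X a) borel W" by simp
  have "distributed M lborel (Y i) (normal_density (s i * \<mu>) \<sigma>)" if "i \<in> {b, c, d}" for i
    using normal_density_affine[of "X i" \<mu> \<sigma> "s i" 0] normal[of i] \<sigma> that
    by (auto simp: Y_def[abs_def] s_def)
  then have "distributed M lborel W
      (normal_density (\<Sum>i\<in>{b, c, d}. s i * \<mu>) (sqrt (\<Sum>i\<in>{b, c, d}. \<sigma>\<^sup>2)))"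
    unfolding W_def[abs_def] using \<sigma>
    by (intro sum_indep_normal indep_vars_subset[OF indepY]) auto
  \<comment> \<open>The means add up to \<open>- \<mu> + \<mu> + \<mu>\<close>, while the sign
    leaves the three variances unchanged.\<close>
  then have distW: "distributed M lborel W ?g"
    using distinct by (auto simp: s_def)
  have distX: "distributed M lborel (X a) (\<lambda>x. ennreal (normal_density \<mu> \<sigma> x))"
    using normal by simp
  have s: "0 < ?s" using \<sigma> by simp
  have s6: "sqrt 2 * ?s = sqrt (6 * \<sigma>\<^sup>2)"
    by (simp add: real_sqrt_mult[symmetric])

  show "emeasure M {\<omega> \<in> space M. X a \<omega> \<in> S \<and> X c \<omega> + X d \<omega> \<le> X a \<omega> + X b \<omega>} =
      (\<integral>\<^sup>+x. ennreal (normal_density \<mu> \<sigma> x * erfc ((\<mu> - x) / sqrt (6 * \<sigma>\<^sup>2)) / 2) * indicator S x \<partial>lborel)"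
    if [measurable]: "S \<in> sets borel"
  proof -
    let ?B = "{(x, w). x \<in> S \<and> w \<le> x} :: (real \<times> real) set"
    have "{p \<in> space (borel \<Otimes>\<^sub>M borel). fst p \<in> S \<and> snd p \<le> fst p} \<in> sets (borel \<Otimes>\<^sub>M (borel :: real measure))"
      by measurable
    then have B: "?B \<in> sets (borel \<Otimes>\<^sub>M borel)"
      by (simp add: space_pair_measure case_prod_beta')
    have "{\<omega> \<in> space M. X a \<omega> \<in> S \<and> X c \<omega> + X d \<omega> \<le> X a \<omega> + X b \<omega>} =
        {\<omega> \<in> space M. (X a \<omega>, W \<omega>) \<in> ?B}"
      by (auto simp: W)
    also have "emeasure M \<dots> =
        (\<integral>\<^sup>+x. ennreal (normal_density \<mu> \<sigma> x) * emeasure (density lborel ?g) (Pair x -` ?B) \<partial>lborel)"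
      by (rule emeasure_indep_var_pair[OF indepW distX distW B])
    also have "\<dots> = (\<integral>\<^sup>+x. ennreal (normal_density \<mu> \<sigma> x * erfc ((\<mu> - x) / sqrt (6 * \<sigma>\<^sup>2)) / 2) * indicator S x \<partial>lborel)"
    proof (rule nn_integral_cong)
      fix x :: real
      have slice: "Pair x -` ?B = (if x \<in> S then {..x} else {})" by auto
      show "ennreal (normal_density \<mu> \<sigma> x) * emeasure (density lborel ?g) (Pair x -` ?B) =
          ennreal (normal_density \<mu> \<sigma> x * erfc ((\<mu> - x) / sqrt (6 * \<sigma>\<^sup>2)) / 2) * indicator S x"
        unfolding slice
        by (simp add: emeasure_normal_atMost[OF s, unfolded s6] ennreal_mult'[symmetric])
    qed
    finally show ?thesis .
  qed

  show "AE \<omega> in M. X c \<omega> + X d \<omega> \<noteq> X a \<omega> + X b \<omega>"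
  proof (rule AE_I)
    let ?B = "{(x, w). x = w} :: (real \<times> real) set"
    have "{p \<in> space (borel \<Otimes>\<^sub>M borel). fst p = snd p} \<in> sets (borel \<Otimes>\<^sub>M (borel :: real measure))"
      by measurable
    then have B: "?B \<in> sets (borel \<Otimes>\<^sub>M borel)"
      by (simp add: space_pair_measure case_prod_beta')
    \<comment> \<open>Each slice of the diagonal is a point, which is null for a law with a Lebesgue
      density.\<close>
    have null: "emeasure (density lborel ?g) (Pair x -` ?B) = 0" for x
    proof -
      have "Pair x -` ?B = {x}" by auto
      moreover have "AE w in lborel. ?g w * indicator {x} w = 0"
        using AE_lborel_singleton[of x] by eventually_elim auto
      ultimately show ?thesis
        by (simp add: emeasure_density nn_integral_0_iff_AE)
    qed
    show "emeasure M {\<omega> \<in> space M. (X a \<omega>, W \<omega>) \<in> ?B} = 0"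
      unfolding emeasure_indep_var_pair[OF indepW distX distW B] null by simp
    show "{\<omega> \<in> space M. (X a \<omega>, W \<omega>) \<in> ?B} \<in> events"
    proof -
      have [measurable]: "X a \<in> borel_measurable M" "W \<in> borel_measurable M"
        using distX distW by (auto simp: distributed_def)
      show ?thesis by simp
    qed
    show "{\<omega> \<in> space M. \<not> X c \<omega> + X d \<omega> \<noteq> X a \<omega> + X b \<omega>} \<subseteq> {\<omega> \<in> space M. (X a \<omega>, W \<omega>) \<in> ?B}"
      by (auto simp: W)
  qed
qed

theorem mainTheorem6:
  fixes M :: "'a measure"
    and X :: "nat \<Rightarrow> nat \<Rightarrow> 'a \<Rightarrow> real"
    and J :: "'a \<Rightarrow> nat"
    and \<mu> \<sigma> :: real
  assumes "prob_space M"
    and "\<sigma> > 0"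
    and "prob_space.indep_vars M (\<lambda>_. borel) (\<lambda>(j, k). X j k) ({1, 2} \<times> {1, 2})"
    and "\<And>j k. j \<in> {1, 2} \<Longrightarrow> k \<in> {1, 2} \<Longrightarrow>
           distributed M lborel (X j k) (\<lambda>x. ennreal (normal_density \<mu> \<sigma> x))"
    and "J \<in> measurable M (count_space {1, 2})"
    and "AE \<omega> in M. \<forall>j\<in>{1, 2}. X j 1 \<omega> + X j 2 \<omega> \<le> X (J \<omega>) 1 \<omega> + X (J \<omega>) 2 \<omega>"
  shows "distributed M lborel (\<lambda>\<omega>. X (J \<omega>) 1 \<omega>)
           (\<lambda>x. ennreal ((2 * pi * \<sigma>\<^sup>2) powr (- 1 / 2)
                  * exp (- ((\<mu> - x)\<^sup>2 / (2 * \<sigma>\<^sup>2)))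
                  * erfc ((\<mu> - x) / sqrt (6 * \<sigma>\<^sup>2))))"
proof -
  interpret prob_space M by fact
  let ?f = "\<lambda>x. normal_density \<mu> \<sigma> x * erfc ((\<mu> - x) / sqrt (6 * \<sigma>\<^sup>2))"
  let ?Z = "\<lambda>\<omega>. X (J \<omega>) 1 \<omega>"
  \<comment> \<open>For \<open>j\<close> in \<open>{1, 2}\<close>, \<open>3 - j\<close> is the other
    index.\<close>
  let ?le = "\<lambda>j \<omega>. X (3 - j) 1 \<omega> + X (3 - j) 2 \<omega> \<le> X j 1 \<omega> + X j 2 \<omega>"
  have [measurable]: "X j k \<in> borel_measurable M" if "j \<in> {1, 2}" "k \<in> {1, 2}" for j k
    using assms(4)[OF that] by (simp add: distributed_def)
  note [measurable] = \<open>J \<in> measurable M (count_space {1, 2})\<close>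
  have J: "J \<omega> = 1 \<or> J \<omega> = 2" if "\<omega> \<in> space M" for \<omega>
    using measurable_space[OF assms(5) that] by simp
  have indep: "indep_vars (\<lambda>_. borel) (\<lambda>(j, k). X j k) {(j, 1), (j, 2), (3 - j, 1), (3 - j, 2)}"
    if "j \<in> {1, 2}" for j
    using that by (intro indep_vars_subset[OF assms(3)]) auto
  have distinct: "distinct [(j, 1), (j, 2), (3 - j, 1), (3 - j, 2 :: nat)]" if "j \<in> {1, 2 :: nat}" for j
    using that by auto
  have normal: "distributed M lborel ((\<lambda>(j, k). X j k) i) (normal_density \<mu> \<sigma>)"
    if "j \<in> {1, 2}" "i \<in> {(j, 1), (j, 2), (3 - j, 1), (3 - j, 2)}" for i j
    using that assms(4) by auto

  have Z [measurable]: "?Z \<in> borel_measurable M"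
  proof -
    \<comment> \<open>A random index is awkward for measurability; as \<open>J\<close> takes only
      two values, a case distinction replaces it.\<close>
    have "(\<lambda>\<omega>. if J \<omega> = 1 then X 1 1 \<omega> else X 2 1 \<omega>) \<in> borel_measurable M"
      by measurable
    then show ?thesis
      by (rule measurable_cong[THEN iffD1, rotated]) (use J in force)
  qed
  have no_tie: "AE \<omega> in M. X 2 1 \<omega> + X 2 2 \<omega> \<noteq> X 1 1 \<omega> + X 1 2 \<omega>"
    using AE_normal_sums_neq[OF assms(2) indep distinct normal[of 1], of 1] by simp
  have win: "emeasure M {\<omega> \<in> space M. X j 1 \<omega> \<in> S \<and> ?le j \<omega>} =
      (\<integral>\<^sup>+x. ennreal (?f x / 2) * indicator S x \<partial>lborel)"
    if "j \<in> {1, 2}" "S \<in> sets borel" for j S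
    using emeasure_normal_sums_le
      [OF assms(2) indep[OF that(1)] distinct[OF that(1)] normal[OF that(1)] that(2)]
    by simp

  have "distributed M lborel ?Z (\<lambda>x. ennreal (?f x))"
    unfolding distributed_def
  proof (intro conjI measure_eqI)
    fix S assume "S \<in> sets (distr M lborel ?Z)"
    then have S [measurable]: "S \<in> sets borel" by simp
    let ?A = "\<lambda>j. {\<omega> \<in> space M. X j 1 \<omega> \<in> S \<and> ?le j \<omega>}"
    have [measurable]: "?A 1 \<in> events" "?A 2 \<in> events"
      by auto
    have "emeasure (distr M lborel ?Z) S = emeasure M {\<omega> \<in> space M. ?Z \<omega> \<in> S}"
      by (subst emeasure_distr) (use Z in \<open>auto intro!: arg_cong[where f="emeasure M"]\<close>)
    \<comment> \<open>Up to null sets this is a disjoint union: \<open>?A 1\<close> and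
      \<open>?A 2\<close> overlap only in ties, and away from ties the maximality of
      \<open>J\<close> decides which sum wins.\<close>
    also have "\<dots> = emeasure M (?A 1) + emeasure M (?A 2)"
    proof (rule emeasure_add_AE)
      show "AE \<omega> in M. \<omega> \<in> {\<omega> \<in> space M. ?Z \<omega> \<in> S} \<longleftrightarrow> \<omega> \<in> ?A 1 \<or> \<omega> \<in> ?A 2"
        using assms(6) no_tie AE_space
      proof eventually_elim
        case (elim \<omega>)
        with J[OF elim(3)] show ?case by (elim disjE) auto
      qed
      show "{\<omega> \<in> space M. ?Z \<omega> \<in> S} \<in> events"
        using measurable_sets[OF Z S] by (simp add: vimage_def Int_def conj_commute)
      show "AE \<omega> in M. \<not> (\<omega> \<in> ?A 1 \<and> \<omega> \<in> ?A 2)"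
        using no_tie by eventually_elim auto
    qed fact+
    also have "\<dots> = (\<integral>\<^sup>+x. ennreal (?f x / 2) * indicator S x + ennreal (?f x / 2) * indicator S x \<partial>lborel)"
      using win[of 1 S] win[of 2 S] by (simp add: nn_integral_add)
    \<comment> \<open>Merging the two halves by \<open>ennreal_plus\<close> requires nonnegative
      summands, hence \<open>erfc_nonneg\<close>.\<close>
    also have "\<dots> = (\<integral>\<^sup>+x. ennreal (?f x) * indicator S x \<partial>lborel)"
      by (intro nn_integral_cong)
        (simp add: distrib_right[symmetric] ennreal_plus[symmetric] erfc_nonneg del: ennreal_plus)
    also have "\<dots> = emeasure (density lborel (\<lambda>x. ennreal (?f x))) S"
      by (subst emeasure_density) auto
    finally show "emeasure (distr M lborel ?Z) S = emeasure (density lborel (\<lambda>x. ennreal (?f x))) S" .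
  qed (use Z in auto)
  also have "?f = (\<lambda>x. (2 * pi * \<sigma>\<^sup>2) powr (- 1 / 2) * exp (- ((\<mu> - x)\<^sup>2 / (2 * \<sigma>\<^sup>2))) *
      erfc ((\<mu> - x) / sqrt (6 * \<sigma>\<^sup>2)))"
    using assms(2)
    by (simp add: normal_density_def powr_minus_divide powr_half_sqrt power2_commute[of \<mu>])
  finally show ?thesis .
qed

end
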